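(* For every $0<\beta<1/5$ there exists $n_0$ such that for every $n\ge n_0$ the following holds: every graph $G$ on $n$ vertices with at least $n^{2-\beta}$ edges has a subgraph $G'$ with at least $\frac{1}{64}n^{2-2\beta}$ edges which is strongly $C_8$-connected.
   Context: A graph $G'$ is $C_{8}$-connected if every pair of edges of $G'$ is contained in a subgraph of $G'$ that is an even-length cycle of length at most $8$. A graph is strongly $C_8$-connected if it is $C_8$-connected and, in addition, every pair of edges that share a vertex lie together on a cycle (in the graph) of length at most $6$. *)

theory Defs
  imports Complex_Main
begin

definition simple_graph :: "'a set \<Rightarrow> 'a set set \<Rightarrow> bool" where
  "simple_graph V E \<longleftrightarrow> finite V \<and> (\<forall>e\<in>E. e \<subseteq> V \<and> card e = 2)"

definition subgraph :: "'a set \<Rightarrow> 'a set set \<Rightarrow> 'a set \<Rightarrow> 'a set set \<Rightarrow> bool" where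
  "subgraph V' E' V E \<longleftrightarrow> simple_graph V' E' \<and> V' \<subseteq> V \<and> E' \<subseteq> E"

text \<open>A cycle is given by the list of its vertices in cyclic order; the first vertex is not
  repeated at the end, so the length of the cycle is the length of the list.\<close>

definition cycle_edges :: "'a list \<Rightarrow> 'a set set" where
  "cycle_edges vs = {{vs ! i, vs ! (Suc i mod length vs)} | i. i < length vs}"

definition cycle_in :: "'a set \<Rightarrow> 'a set set \<Rightarrow> 'a list \<Rightarrow> bool" where
  "cycle_in V E vs \<longleftrightarrow>
     length vs \<ge> 3 \<and> distinct vs \<and> subgraph (set vs) (cycle_edges vs) V E"

definition C8_connected :: "'a set \<Rightarrow> 'a set set \<Rightarrow> bool" where
  "C8_connected V E \<longleftrightarrow>
     (\<forall>e\<in>E. \<forall>f\<in>E. e \<noteq> f \<longrightarrow>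
        (\<exists>vs. cycle_in V E vs \<and> even (length vs) \<and> length vs \<le> 8 \<and>
              e \<in> cycle_edges vs \<and> f \<in> cycle_edges vs))"

definition strongly_C8_connected :: "'a set \<Rightarrow> 'a set set \<Rightarrow> bool" where
  "strongly_C8_connected V E \<longleftrightarrow> C8_connected V E \<and>
     (\<forall>e\<in>E. \<forall>f\<in>E. e \<noteq> f \<and> e \<inter> f \<noteq> {} \<longrightarrow>
        (\<exists>vs. cycle_in V E vs \<and> length vs \<le> 6 \<and>
              e \<in> cycle_edges vs \<and> f \<in> cycle_edges vs))"

end

theory Submission
  imports Defs "HOL-Analysis.Convex"
begin

text \<open>Pass to a bipartite subgraph with parts \<open>A\<close>, \<open>B\<close>, where \<open>card A \<le> card B\<close>, and minimum degree
  \<open>d\<close> about \<open>n powr (1 - \<beta>) / 3\<close>, and use dependent random choice with a single vertex \<open>v \<in> B\<close>: let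
  \<open>U\<close> be its neighbourhood and \<open>B'\<close> the set of all \<open>b \<in> B\<close> having at least \<open>s = d\<^sup>2 / (2 * n)\<close>
  common neighbours with \<open>v\<close>. Call a pair in \<open>U\<close> bad if it has at most three common neighbours in
  \<open>B'\<close>. By Cauchy-Schwarz, a fixed pair in \<open>A\<close> is bad for at most \<open>6 * n / d\<close> choices of \<open>v\<close>, so some
  \<open>v\<close> has at most \<open>6 * n\<^sup>2 / d\<close> bad pairs. As \<open>\<beta> < 1 / 5\<close>, the vertices in more than \<open>s / 8\<close> bad
  pairs number at most \<open>s / 4\<close>; after deleting them from \<open>U\<close> every vertex of \<open>B'\<close> still has degree at
  least \<open>3 * s / 4\<close>, and the remaining graph has at least \<open>3 * d\<^sup>2 / 8\<close> edges. Two edges \<open>a b\<close> and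
  \<open>a' b'\<close> then lie on a cycle \<open>a b y c' a' b' x c\<close>, choosing \<open>x\<close> adjacent to \<open>b'\<close> and good with \<open>a\<close>,
  \<open>y\<close> adjacent to \<open>b\<close> and good with \<open>a'\<close>, and \<open>c\<close>, \<open>c'\<close> as common neighbours; edges sharing a
  vertex are joined by 6-cycles in the same way.\<close>

section \<open>Double counting and Cauchy-Schwarz\<close>

lemma sum_card_swap:
  assumes "finite A" "finite B"
  shows "(\<Sum>a\<in>A. card {b\<in>B. Q a b}) = (\<Sum>b\<in>B. card {a\<in>A. Q a b})"
proof -
  have "(\<Sum>a\<in>A. card {b\<in>B. Q a b}) = (\<Sum>a\<in>A. \<Sum>b\<in>B. if Q a b then 1 else 0)"
    using assms by (simp only: card_eq_sum sum.inter_filter)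
  also have "\<dots> = (\<Sum>b\<in>B. \<Sum>a\<in>A. if Q a b then 1 else 0)"
    by (rule sum.swap)
  also have "\<dots> = (\<Sum>b\<in>B. card {a\<in>A. Q a b})"
    using assms by (simp only: card_eq_sum sum.inter_filter)
  finally show ?thesis .
qed

text \<open>Cauchy-Schwarz on the degrees in \<open>A\<close> makes the codegrees over
  \<open>L \<times> L\<close> sum to at least \<open>(m * d)^2 / n\<close>, where
  \<open>m = card L\<close>. For each \<open>v\<close> at most \<open>k\<close> codegrees reach
  \<open>s\<close>, each being at most \<open>d\<close>, and the others add at most
  \<open>m * s\<close>. As \<open>2 * n * s \<le> d^2\<close>, these others account for at most half
  of the lower bound, and the other half yields the claim.\<close>

lemma low_codegree_bound:
  fixes N :: "'b \<Rightarrow> 'a set" and s :: real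
  assumes finA: "finite A" and finL: "finite L"
    and N: "\<And>b. b \<in> L \<Longrightarrow> N b \<subseteq> A" "\<And>b. b \<in> L \<Longrightarrow> card (N b) = d"
    and An: "card A \<le> n" and s: "2 * n * s \<le> real d ^ 2" "0 \<le> s" and d: "0 < d" and n: "0 < n"
    and few: "\<And>v. v \<in> L \<Longrightarrow> card {b\<in>L. s \<le> card (N b \<inter> N v)} \<le> k"
  shows "card L * d \<le> 2 * k * n"
proof -
  define deg where "deg a = card {b\<in>L. a \<in> N b}" for a
  define m where "m = real (card L)"
  have "(\<Sum>a\<in>A. deg a) = (\<Sum>b\<in>L. card {a\<in>A. a \<in> N b})"
    unfolding deg_def by (rule sum_card_swap[OF finA finL])
  also have "\<dots> = (\<Sum>b\<in>L. d)"
    by (rule sum.cong) (use N in \<open>auto simp: Int_absorb1 Collect_conj_eq\<close>)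
  finally have sumdeg: "(\<Sum>a\<in>A. real (deg a)) = m * d"
    unfolding m_def by (simp flip: of_nat_sum)
  have "(\<Sum>a\<in>A. (deg a)\<^sup>2) = (\<Sum>a\<in>A. card {p\<in>L \<times> L. a \<in> N (fst p) \<and> a \<in> N (snd p)})"
  proof (rule sum.cong)
    fix a
    have "{p\<in>L \<times> L. a \<in> N (fst p) \<and> a \<in> N (snd p)} = {b\<in>L. a \<in> N b} \<times> {b\<in>L. a \<in> N b}" by auto
    then show "(deg a)\<^sup>2 = card {p\<in>L \<times> L. a \<in> N (fst p) \<and> a \<in> N (snd p)}"
      by (simp add: deg_def power2_eq_square card_cartesian_product)
  qed simp
  also have "\<dots> = (\<Sum>p\<in>L\<times>L. card {a\<in>A. a \<in> N (fst p) \<and> a \<in> N (snd p)})"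
    by (rule sum_card_swap) (use finA finL in auto)
  also have "\<dots> = (\<Sum>p\<in>L\<times>L. card (N (snd p) \<inter> N (fst p)))"
  proof (rule sum.cong)
    fix p assume "p \<in> L \<times> L"
    then have "{a\<in>A. a \<in> N (fst p) \<and> a \<in> N (snd p)} = N (snd p) \<inter> N (fst p)"
      using N(1)[of "fst p"] by auto
    then show "card {a\<in>A. a \<in> N (fst p) \<and> a \<in> N (snd p)} = card (N (snd p) \<inter> N (fst p))" by simp
  qed simp
  also have "\<dots> = (\<Sum>v\<in>L. \<Sum>b\<in>L. card (N b \<inter> N v))"
    by (simp add: sum.cartesian_product case_prod_unfold)
  finally have sq: "(\<Sum>a\<in>A. (real (deg a))\<^sup>2) = (\<Sum>v\<in>L. \<Sum>b\<in>L. real (card (N b \<inter> N v)))"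
    by (simp flip: of_nat_sum of_nat_power)
  have "(\<Sum>b\<in>L. real (card (N b \<inter> N v))) \<le> k * d + m * s" if v: "v \<in> L" for v
  proof -
    let ?H = "{b\<in>L. s \<le> card (N b \<inter> N v)}"
    have "(\<Sum>b\<in>L. real (card (N b \<inter> N v))) \<le> (\<Sum>b\<in>L. (if b \<in> ?H then real d else 0) + s)"
    proof (rule sum_mono)
      fix b assume b: "b \<in> L"
      have "card (N b \<inter> N v) \<le> card (N v)"
        using N(1)[OF v] finA by (intro card_mono) (auto intro: finite_subset)
      then show "real (card (N b \<inter> N v)) \<le> (if b \<in> ?H then real d else 0) + s"
        using b N(2)[OF v] s(2) by auto
    qed
    also have "\<dots> = card ?H * d + m * s"
      using finL by (simp add: sum.distrib m_def flip: sum.inter_filter)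
    also have "\<dots> \<le> k * d + m * s"
      using few[OF v] by (simp add: mult_right_mono flip: of_nat_mult)
    finally show ?thesis .
  qed
  then have "(\<Sum>a\<in>A. (real (deg a))\<^sup>2) \<le> (\<Sum>v\<in>L. k * d + m * s)"
    unfolding sq by (intro sum_mono)
  then have up: "(\<Sum>a\<in>A. (real (deg a))\<^sup>2) \<le> m * (k * d + m * s)"
    by (simp add: m_def)
  have "(m * d)\<^sup>2 \<le> card A * (\<Sum>a\<in>A. (real (deg a))\<^sup>2)"
    using sum_squared_le_sum_of_squares[of "\<lambda>a. real (deg a)" A] by (simp add: sumdeg mult.commute)
  also have "\<dots> \<le> n * (m * (k * d + m * s))"
    using up An by (intro mult_mono) (auto intro: sum_nonneg)
  finally have "m\<^sup>2 * (real d)\<^sup>2 \<le> n * m * k * d + m\<^sup>2 * (n * s)"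
    by (simp add: algebra_simps power2_eq_square)
  moreover have "m\<^sup>2 * (2 * (n * s)) \<le> m\<^sup>2 * (real d)\<^sup>2"
    using s by (intro mult_left_mono) auto
  ultimately have "m\<^sup>2 * (real d)\<^sup>2 \<le> 2 * (n * m * k * d)"
    by simp
  then have "m * d * (m * d) \<le> m * d * (2 * k * n)"
    by (simp add: algebra_simps power2_eq_square)
  moreover have "m \<ge> 0" by (simp add: m_def)
  ultimately have "m * d \<le> 2 * k * n"
    using d by (cases "m = 0") auto
  then have "real (card L * d) \<le> real (2 * k * n)" by (simp add: m_def)
  then show ?thesis by (simp only: of_nat_le_iff)
qed

section \<open>Bipartite subgraphs of large minimum degree\<close>

text \<open>Induction on the vertices: each new vertex goes to the side that cuts at least half of
  its edges to the earlier ones. Pairs are ordered from \<open>X\<close> to \<open>V - X\<close>, so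
  every cut edge is counted once.\<close>

lemma max_cut:
  assumes "finite V" and "\<And>e. e \<in> E \<Longrightarrow> e \<subseteq> V \<and> card e = 2"
  shows "\<exists>X\<subseteq>V. card E \<le> 2 * card {(x, y). x \<in> X \<and> y \<in> V - X \<and> {x, y} \<in> E}"
  using assms
proof (induction V arbitrary: E rule: finite_induct)
  case empty
  then have "E = {}" by fastforce
  then show ?case by simp
next
  case (insert v V)
  define E0 where "E0 = {e\<in>E. v \<notin> e}"
  define N where "N = {y\<in>V. {v, y} \<in> E}"
  have E0: "e \<subseteq> V \<and> card e = 2" if "e \<in> E0" for e
    using that insert.prems[of e] by (auto simp: E0_def)
  from insert.IH[of E0, OF E0] obtain X where X: "X \<subseteq> V"
      "card E0 \<le> 2 * card {(x, y). x \<in> X \<and> y \<in> V - X \<and> {x, y} \<in> E0}" (is "_ \<le> 2 * card ?C0")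
    by auto
  have fin: "finite N" "finite X" "finite ?C0"
    using insert.hyps X(1) by (auto simp: N_def intro: finite_subset finite_subset[of _ "V \<times> V"])
  have "E \<subseteq> E0 \<union> (\<lambda>y. {v, y}) ` N"
  proof
    fix e assume e: "e \<in> E"
    show "e \<in> E0 \<union> (\<lambda>y. {v, y}) ` N"
    proof (cases "v \<in> e")
      case True
      obtain y where "e = {v, y}" "y \<noteq> v"
        using insert.prems[OF e] True by (auto simp: card_2_iff)
      then show ?thesis using insert.prems[OF e] e by (auto simp: N_def)
    qed (use e in \<open>simp add: E0_def\<close>)
  qed
  moreover have "finite E0"
    using insert.hyps insert.prems by (intro finite_subset[of E0 "Pow (insert v V)"]) (auto simp: E0_def)
  ultimately have "card E \<le> card E0 + card N"
    by (meson add_left_mono card_Un_le card_image_le card_mono fin(1) finite_UnI finite_imageI le_trans)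
  moreover have "card N = card (N \<inter> X) + card (N - X)"
    using fin(1) by (metis card_Diff_subset_Int card_Int_Diff)
  ultimately have "card E \<le> 2 * (card ?C0 + card (N \<inter> X)) \<or> card E \<le> 2 * (card ?C0 + card (N - X))"
    using X(2) by (auto simp flip: not_less)
  then show ?case
  proof
    assume *: "card E \<le> 2 * (card ?C0 + card (N \<inter> X))"
    have "{(x, y). x \<in> X \<and> y \<in> insert v V - X \<and> {x, y} \<in> E} = ?C0 \<union> (\<lambda>x. (x, v)) ` (N \<inter> X)"
      using X(1) insert.hyps by (auto simp: N_def E0_def insert_commute)
    moreover have "?C0 \<inter> (\<lambda>x. (x, v)) ` (N \<inter> X) = {}" using insert.hyps by auto
    ultimately have "card {(x, y). x \<in> X \<and> y \<in> insert v V - X \<and> {x, y} \<in> E} = card ?C0 + card (N \<inter> X)"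
      using fin by (simp add: card_Un_disjoint card_image inj_on_def)
    then show ?thesis using * X(1) by (intro exI[of _ X]) auto
  next
    assume *: "card E \<le> 2 * (card ?C0 + card (N - X))"
    have "{(x, y). x \<in> insert v X \<and> y \<in> insert v V - insert v X \<and> {x, y} \<in> E} = ?C0 \<union> Pair v ` (N - X)"
      using X(1) insert.hyps by (auto simp: N_def E0_def)
    moreover have "?C0 \<inter> Pair v ` (N - X) = {}" using insert.hyps X(1) by auto
    ultimately have "card {(x, y). x \<in> insert v X \<and> y \<in> insert v V - insert v X \<and> {x, y} \<in> E}
        = card ?C0 + card (N - X)"
      using fin by (simp add: card_Un_disjoint card_image inj_on_def)
    then show ?thesis using * X(1) by (intro exI[of _ "insert v X"]) auto
  qed
qed

text \<open>Deleting a vertex of degree below \<open>d\<close> loses fewer than \<open>d\<close>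
  edges, while \<open>d * (card A + card B)\<close> drops by \<open>d\<close>. The strict inequality
  therefore survives every deletion, and it also keeps the final relation nonempty.\<close>

lemma min_degree_subgraph:
  assumes "finite A" "finite B" "R \<subseteq> A \<times> B" "d * (card A + card B) < card R"
  shows "\<exists>A' B'. A' \<subseteq> A \<and> B' \<subseteq> B \<and> R \<inter> A' \<times> B' \<noteq> {} \<and>
    (\<forall>a\<in>A'. d \<le> card ((R \<inter> A' \<times> B') `` {a})) \<and> (\<forall>b\<in>B'. d \<le> card ((R \<inter> A' \<times> B')\<inverse> `` {b}))"
  using assms
proof (induction "card A + card B" arbitrary: A B R rule: less_induct)
  case less
  have R: "R \<inter> A \<times> B = R" using less.prems by auto
  consider "(\<forall>a\<in>A. d \<le> card (R `` {a})) \<and> (\<forall>b\<in>B. d \<le> card (R\<inverse> `` {b}))"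
    | a where "a \<in> A" "card (R `` {a}) < d" | b where "b \<in> B" "card (R\<inverse> `` {b}) < d"
    using not_le by blast
  then show ?case
  proof cases
    case 1
    then show ?thesis using less.prems R by (intro exI[of _ A] exI[of _ B]) auto
  next
    case 2
    let ?A = "A - {a}" and ?R = "R \<inter> (A - {a}) \<times> B"
    have c: "card A = Suc (card ?A)" using less.prems(1) 2(1) by (rule card.remove)
    have "R = ?R \<union> Pair a ` (R `` {a})" using less.prems(3) by auto
    then have "card R \<le> card ?R + card (Pair a ` (R `` {a}))" by (metis card_Un_le)
    also have "card (Pair a ` (R `` {a})) = card (R `` {a})" by (simp add: card_image inj_on_def)
    finally have "d * (card ?A + card B) < card ?R" using 2(2) less.prems(4) c by simp
    from less.hyps[OF _ _ _ _ this] c less.prems obtain A' B' where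
      *: "A' \<subseteq> ?A" "B' \<subseteq> B" "?R \<inter> A' \<times> B' \<noteq> {}" "\<forall>a\<in>A'. d \<le> card ((?R \<inter> A' \<times> B') `` {a})"
         "\<forall>b\<in>B'. d \<le> card ((?R \<inter> A' \<times> B')\<inverse> `` {b})" by auto
    moreover have "?R \<inter> A' \<times> B' = R \<inter> A' \<times> B'" using *(1,2) by auto
    ultimately show ?thesis by (intro exI[of _ A'] exI[of _ B']) auto
  next
    case 3
    let ?B = "B - {b}" and ?R = "R \<inter> A \<times> (B - {b})"
    have c: "card B = Suc (card ?B)" using less.prems(2) 3(1) by (rule card.remove)
    have "R = ?R \<union> (\<lambda>a. (a, b)) ` (R\<inverse> `` {b})" using less.prems(3) by auto
    then have "card R \<le> card ?R + card ((\<lambda>a. (a, b)) ` (R\<inverse> `` {b}))" by (metis card_Un_le)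
    also have "card ((\<lambda>a. (a, b)) ` (R\<inverse> `` {b})) = card (R\<inverse> `` {b})" by (simp add: card_image inj_on_def)
    finally have "d * (card A + card ?B) < card ?R" using 3(2) less.prems(4) c by simp
    from less.hyps[OF _ _ _ _ this] c less.prems obtain A' B' where
      *: "A' \<subseteq> A" "B' \<subseteq> ?B" "?R \<inter> A' \<times> B' \<noteq> {}" "\<forall>a\<in>A'. d \<le> card ((?R \<inter> A' \<times> B') `` {a})"
         "\<forall>b\<in>B'. d \<le> card ((?R \<inter> A' \<times> B')\<inverse> `` {b})" by auto
    moreover have "?R \<inter> A' \<times> B' = R \<inter> A' \<times> B'" using *(1,2) by auto
    ultimately show ?thesis by (intro exI[of _ A'] exI[of _ B']) auto
  qed
qed

text \<open>\<open>D\<close> bounds the number of vertices with which a given left vertex has too few (at most three)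
  common neighbours; right degrees above \<open>2 * D + 3\<close> leave a choice of neighbour that avoids the bad
  partners of two given vertices and three further vertices.\<close>

definition rich :: "('a \<times> 'b) set \<Rightarrow> bool" where
  "rich R \<longleftrightarrow> (\<exists>D. (\<forall>a\<in>Domain R. card {a'\<in>Domain R. card (R `` {a} \<inter> R `` {a'}) < 4} \<le> D) \<and>
                 (\<forall>b\<in>Range R. 2 * D + 4 \<le> card (R\<inverse> `` {b})))"

section \<open>Dependent random choice\<close>

lemma rich_subrelation:
  fixes R :: "('a \<times> 'b) set" and n d :: nat
  assumes finA: "finite A" and finB: "finite B" and R: "R \<subseteq> A \<times> B"
    and AB: "card A \<le> card B" and Bn: "card B \<le> n" and B: "B \<noteq> {}"
    and degA: "\<And>a. a \<in> A \<Longrightarrow> d \<le> card (R `` {a})" and degB: "\<And>b. b \<in> B \<Longrightarrow> d \<le> card (R\<inverse> `` {b})"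
    and d5: "1024 * n ^ 4 \<le> d ^ 5" and d2: "40 * n \<le> d ^ 2"
  shows "\<exists>R'\<subseteq>R. 3 * d ^ 2 \<le> 8 * card R' \<and> rich R'"
proof -
  have B0: "0 < card B" using finB B by (simp add: card_gt_0_iff)
  then have n0: "0 < n" using Bn by simp
  have d0: "0 < d" using d2 n0 by (cases "d = 0") auto
  \<comment> \<open>The largest threshold that \<open>low_codegree_bound\<close> admits.\<close>
  define s where "s = real d ^ 2 / (2 * n)"
  have ns: "n * s = real d ^ 2 / 2" using n0 by (simp add: s_def field_simps)
  have "real (40 * n) \<le> real (d ^ 2)" using d2 by (simp only: of_nat_le_iff)
  then have "n * 20 \<le> n * s" by (simp add: ns)
  then have s20: "20 \<le> s" using n0 by simp
  define M where "M b = R\<inverse> `` {b}" for b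
  have MA: "M b \<subseteq> A" for b using R by (auto simp: M_def)
  then have finM: "finite (M b)" for b using finA finite_subset by blast
  have "\<exists>T. T \<subseteq> M b \<and> card T = d" if "b \<in> B" for b
    using degB[OF that] obtain_subset_with_card_n[of d "M b"] unfolding M_def by metis
  \<comment> \<open>Trimming the neighbourhoods to exactly \<open>d\<close> vertices caps all codegrees at \<open>d\<close>; without this cap
    the Cauchy-Schwarz bound below loses a factor \<open>n / d\<close>, which would only give exponents below 1/6.\<close>
  then obtain N where N: "\<And>b. b \<in> B \<Longrightarrow> N b \<subseteq> M b \<and> card (N b) = d" by metis
  \<comment> \<open>The common neighbours of \<open>a\<close> and \<open>a'\<close> inside the later
    set \<open>B'\<close>, written as a function of \<open>v\<close> because \<open>v\<close> is
    still to be chosen.\<close>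
  define common where "common a a' v = {b\<in>B. (a, b) \<in> R \<and> (a', b) \<in> R \<and> s \<le> card (M b \<inter> M v)}" for a a' v
  have fincommon: "finite (common a a' v)" for a a' v using finB by (simp add: common_def)
  define bad where "bad p v \<longleftrightarrow> (fst p, v) \<in> R \<and> (snd p, v) \<in> R \<and> card (common (fst p) (snd p) v) < 4" for p v
  have few_bad: "card {v\<in>B. bad p v} * d \<le> 6 * n" for p
  proof -
    let ?L = "{v\<in>B. bad p v}"
    have "card ?L * d \<le> 2 * 3 * n"
    proof (rule low_codegree_bound[of A ?L N d n s 3])
      fix v assume v: "v \<in> ?L"
      \<comment> \<open>Every member of \<open>?L\<close> is bad for \<open>p\<close>, hence
        adjacent to both vertices of \<open>p\<close>; a large codegree with \<open>v\<close> is
        then all that membership in \<open>common\<close> still asks for.\<close>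
      have "{b\<in>?L. s \<le> card (N b \<inter> N v)} \<subseteq> common (fst p) (snd p) v"
      proof
        fix b assume b: "b \<in> {b\<in>?L. s \<le> card (N b \<inter> N v)}"
        have "card (N b \<inter> N v) \<le> card (M b \<inter> M v)"
          using N b v finM by (intro card_mono) auto
        then show "b \<in> common (fst p) (snd p) v"
          using b by (auto simp: common_def bad_def)
      qed
      then have "card {b\<in>?L. s \<le> card (N b \<inter> N v)} \<le> card (common (fst p) (snd p) v)"
        by (intro card_mono fincommon)
      then show "card {b\<in>?L. s \<le> card (N b \<inter> N v)} \<le> 3"
        using v by (simp add: bad_def)
    next
      show "2 * real n * s \<le> (real d)\<^sup>2" using ns by simp
    qed (use finA finB N MA AB Bn s20 d0 n0 in \<open>auto dest!: subsetD\<close>)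
    then show ?thesis by simp
  qed
  have "\<exists>v\<in>B. card {p\<in>A\<times>A. bad p v} * d \<le> 6 * n\<^sup>2"
  proof (rule ccontr)
    assume "\<not> ?thesis"
    then have "(\<Sum>v\<in>B. 6 * n\<^sup>2) < (\<Sum>v\<in>B. card {p\<in>A\<times>A. bad p v} * d)"
      using finB B by (intro sum_strict_mono) (auto simp: not_le)
    also have "\<dots> = (\<Sum>p\<in>A\<times>A. card {v\<in>B. bad p v} * d)"
      using sum_card_swap[of B "A \<times> A" "\<lambda>v p. bad p v"] finA finB
      by (simp flip: sum_distrib_right)
    also have "\<dots> \<le> (\<Sum>p\<in>A\<times>A. 6 * n)"
      by (intro sum_mono few_bad)
    also have "\<dots> = 6 * n * (card A * card A)" by (simp add: card_cartesian_product)
    \<comment> \<open>Here \<open>A\<close> has to be the smaller side: one factor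
      \<open>card A\<close> becomes \<open>card B\<close>, which cancels in the average over
      \<open>v\<close>.\<close>
    also have "\<dots> \<le> 6 * n * (n * card B)" using AB Bn by (intro mult_mono) auto
    finally show False by (simp add: power2_eq_square)
  qed
  then obtain v where v: "v \<in> B" and badv: "card {p\<in>A\<times>A. bad p v} * d \<le> 6 * n\<^sup>2" by blast
  define P where "P a = {a'\<in>A. bad (a, a') v}" for a
  define W where "W = {a\<in>A. s / 8 < card (P a)}"
  define B' where "B' = {b\<in>B. s \<le> card (M b \<inter> M v)}"
  define R' where "R' = R \<inter> (M v - W) \<times> B'"
  have finW: "finite W" using finA by (simp add: W_def)
  have finR: "finite R" using R finA finB finite_subset by blast
  have "{p\<in>A\<times>A. bad p v} = Sigma A P" by (auto simp: P_def)
  then have "card {p\<in>A\<times>A. bad p v} = (\<Sum>a\<in>A. card (P a))"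
    using finA by (simp add: P_def card_SigmaI)
  also have "\<dots> \<ge> (\<Sum>a\<in>W. card (P a))"
    using finA by (intro sum_mono2) (auto simp: W_def)
  finally have "real (\<Sum>a\<in>W. card (P a)) \<le> card {p\<in>A\<times>A. bad p v}" by (simp only: of_nat_le_iff)
  moreover have "(\<Sum>a\<in>W. s / 8) \<le> (\<Sum>a\<in>W. real (card (P a)))"
    by (intro sum_mono) (auto simp: W_def)
  ultimately have "card W * (s / 8) \<le> card {p\<in>A\<times>A. bad p v}" by simp
  then have "card W * (s / 8) * d \<le> card {p\<in>A\<times>A. bad p v} * d" unfolding of_nat_mult by (rule mult_right_mono) simp
  also have "\<dots> \<le> real (6 * n\<^sup>2)" using badv by (simp only: of_nat_le_iff flip: of_nat_mult)
  finally have Wle: "card W * (s * d) \<le> 48 * real n ^ 2" by simp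
  \<comment> \<open>The hypothesis \<open>d5\<close>, source of the condition \<open>\<beta> < 1 / 5\<close>, is used here: deleting \<open>W\<close> must not use up the degrees of \<open>B'\<close>.\<close>
  have W: "card W \<le> s / 4"
  proof (rule ccontr)
    assume "\<not> ?thesis"
    then have "s / 4 * (s * d) < card W * (s * d)"
      using s20 d0 by (intro mult_strict_right_mono) auto
    then have "s * s * d < 192 * real n ^ 2" using Wle by linarith
    \<comment> \<open>The factor \<open>n * n\<close> allows both copies of \<open>n * s\<close> to
      be replaced by \<open>d^2 / 2\<close>, which leaves a comparison of \<open>d^5\<close> with
      \<open>n^4\<close>.\<close>
    then have "n * n * (s * s * d) < n * n * (192 * real n ^ 2)"
      using n0 by (intro mult_strict_left_mono) auto
    also have "n * n * (s * s * d) = (n * s) * (n * s) * d" by simp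
    finally have "real d ^ 5 < 768 * real n ^ 4"
      by (simp add: ns power2_eq_square eval_nat_numeral)
    moreover have "real (1024 * n ^ 4) \<le> real (d ^ 5)" using d5 by (simp only: of_nat_le_iff)
    moreover have "0 \<le> real n ^ 4" by simp
    ultimately show False by simp
  qed
  have deg: "3 * s / 4 \<le> card (R'\<inverse> `` {b})" if "b \<in> B'" for b
  proof -
    have "R'\<inverse> `` {b} = (M b \<inter> M v) - W"
      using that by (auto simp: R'_def M_def)
    then have "card (M b \<inter> M v) - card W \<le> card (R'\<inverse> `` {b})"
      using finW by (simp add: diff_card_le_card_Diff)
    moreover have "s \<le> card (M b \<inter> M v)" using that by (simp add: B'_def)
    ultimately show ?thesis using W by linarith
  qed
  have bad': "card {a'\<in>Domain R'. card (R' `` {a} \<inter> R' `` {a'}) < 4} \<le> s / 8" if a: "a \<in> Domain R'" for a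
  proof -
    have "a' \<in> P a" if "a' \<in> Domain R'" "card (R' `` {a} \<inter> R' `` {a'}) < 4" for a'
    proof -
      have aa: "a \<in> M v - W" "a' \<in> M v - W" using a that by (auto simp: R'_def)
      \<comment> \<open>Deleting \<open>W\<close> removes left vertices only, so the common
        neighbourhoods of surviving pairs are unchanged.\<close>
      then have "R' `` {a} \<inter> R' `` {a'} = common a a' v"
        by (auto simp: R'_def common_def B'_def)
      then show ?thesis using that aa MA by (auto simp: P_def bad_def M_def)
    qed
    then have "card {a'\<in>Domain R'. card (R' `` {a} \<inter> R' `` {a'}) < 4} \<le> card (P a)"
      using finA by (intro card_mono) (auto simp: P_def)
    moreover have "card (P a) \<le> s / 8" using a MA by (auto simp: R'_def W_def)
    ultimately show ?thesis by linarith
  qed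
  \<comment> \<open>Since \<open>D \<le> s / 8\<close> and \<open>20 \<le> s\<close>, the degree
    bound \<open>3 * s / 4\<close> leaves room for \<open>2 * D + 4\<close>.\<close>
  define D where "D = nat \<lfloor>s / 8\<rfloor>"
  have D: "real D \<le> s / 8" unfolding D_def using s20 by linarith
  have "rich R'" unfolding rich_def
  proof (intro exI[of _ D] conjI ballI)
    fix a assume "a \<in> Domain R'"
    from bad'[OF this] show "card {a'\<in>Domain R'. card (R' `` {a} \<inter> R' `` {a'}) < 4} \<le> D"
      unfolding D_def by (simp add: le_nat_floor)
  next
    fix b assume "b \<in> Range R'"
    then have "b \<in> B'" by (auto simp: R'_def)
    from deg[OF this] D s20 show "2 * D + 4 \<le> card (R'\<inverse> `` {b})" by linarith
  qed
  moreover have "3 * d ^ 2 \<le> 8 * card R'"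
  proof -
    \<comment> \<open>\<open>?S\<close> represents all edges at \<open>M v\<close>, at least
      \<open>d * d\<close> of them. A lost edge meets \<open>W\<close>, at most
      \<open>s / 4 * n\<close> cases, or ends in \<open>B - B'\<close>, where each vertex has fewer
      than \<open>s\<close> neighbours in \<open>M v\<close>, at most \<open>s * n\<close> cases.
      The loss is at most \<open>5 / 4 * (n * s)\<close>, which is 5/8 of
      \<open>d^2\<close>.\<close>
    let ?S = "SIGMA a:M v. R `` {a}" and ?T = "SIGMA b:B - B'. M b \<inter> M v"
    have "d * d \<le> d * card (M v)" using degB[OF v] by (simp add: M_def)
    also have "\<dots> \<le> (\<Sum>a\<in>M v. card (R `` {a}))"
      using sum_mono[of "M v" "\<lambda>_. d" "\<lambda>a. card (R `` {a})"] degA MA by (auto simp: mult.commute)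
    also have "\<dots> = card ?S"
      using finM finR by (intro card_SigmaI[symmetric]) (auto simp: finite_Image)
    also have "\<dots> \<le> card (R' \<union> W \<times> B \<union> ?T\<inverse>)"
    proof (rule card_mono)
      show "finite (R' \<union> W \<times> B \<union> ?T\<inverse>)"
        using finR finB finW finM by (auto simp: R'_def)
      show "?S \<subseteq> R' \<union> W \<times> B \<union> ?T\<inverse>" using R by (auto simp: R'_def M_def)
    qed
    also have "\<dots> \<le> card R' + card (W \<times> B) + card (?T\<inverse>)"
      by (meson add_right_mono card_Un_le le_trans)
    finally have "real (d * d) \<le> card R' + card W * card B + card ?T"
      by (simp add: card_cartesian_product flip: of_nat_mult of_nat_add)
    moreover have "card W * card B \<le> s / 4 * n"
      unfolding of_nat_mult using W Bn s20 by (intro mult_mono) auto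
    moreover have "real (card ?T) \<le> s * n"
    proof -
      have "real (card ?T) = (\<Sum>b\<in>B - B'. real (card (M b \<inter> M v)))"
        using finB finM by (subst card_SigmaI) auto
      also have "\<dots> \<le> (\<Sum>b\<in>B - B'. s)"
        by (intro sum_mono) (auto simp: B'_def)
      also have "\<dots> = s * card (B - B')" by simp
      also have "card (B - B') \<le> card B" using finB by (intro card_mono) auto
      then have "s * card (B - B') \<le> s * n" using Bn s20 by (intro mult_left_mono) auto
      finally show ?thesis by simp
    qed
    ultimately have "real (d * d) \<le> card R' + 5 / 4 * (n * s)" by (simp add: algebra_simps)
    then have "real (3 * d ^ 2) \<le> real (8 * card R')" by (simp add: ns power2_eq_square)
    then show ?thesis by (simp only: of_nat_le_iff)
  qed
  ultimately show ?thesis by (intro exI[of _ R']) (auto simp: R'_def)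
qed

section \<open>Short cycles through two edges of a rich relation\<close>

lemma cycle_inI:
  assumes "3 \<le> length vs" "distinct vs" "set vs \<subseteq> V" "cycle_edges vs \<subseteq> E"
  shows "cycle_in V E vs"
proof -
  have "card {vs ! i, vs ! (Suc i mod length vs)} = 2 \<and> {vs ! i, vs ! (Suc i mod length vs)} \<subseteq> set vs"
    if i: "i < length vs" for i
  proof -
    have "Suc i mod length vs < length vs" using i by (intro mod_less_divisor) auto
    moreover have "Suc i mod length vs \<noteq> i"
      using i assms(1) by (cases "Suc i = length vs") auto
    ultimately show ?thesis using i assms(2) by (auto simp: nth_eq_iff_index_eq card_2_iff)
  qed
  then show ?thesis
    using assms by (auto simp: cycle_in_def subgraph_def simple_graph_def cycle_edges_def)
qed

lemma cycle_edges_image: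
  "cycle_edges vs = (\<lambda>i. {vs ! i, vs ! (Suc i mod length vs)}) ` {..<length vs}"
  by (auto simp: cycle_edges_def)

lemma cycle_edges_6:
  "cycle_edges [p, q, r, s, t, u] = {{p, q}, {q, r}, {r, s}, {s, t}, {t, u}, {u, p}}"
  by (simp add: cycle_edges_image lessThan_Suc insert_commute)

lemma cycle_edges_8:
  "cycle_edges [p, q, r, s, t, u, x, y] =
    {{p, q}, {q, r}, {r, s}, {s, t}, {t, u}, {u, x}, {x, y}, {y, p}}"
  by (simp add: cycle_edges_image lessThan_Suc insert_commute)

lemma rich_strongly_C8_connected:
  fixes R :: "('a \<times> 'a) set"
  assumes rich: "rich R" and fin: "finite R" and disj: "Domain R \<inter> Range R = {}"
    and V: "Domain R \<union> Range R \<subseteq> V"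
  shows "strongly_C8_connected V ((\<lambda>(a, b). {a, b}) ` R)" (is "strongly_C8_connected V ?E")
proof -
  define bad where "bad a = {a'\<in>Domain R. card (R `` {a} \<inter> R `` {a'}) < 4}" for a
  obtain D where D: "\<And>a. a \<in> Domain R \<Longrightarrow> card (bad a) \<le> D"
      "\<And>b. b \<in> Range R \<Longrightarrow> 2 * D + 4 \<le> card (R\<inverse> `` {b})"
    using rich unfolding rich_def bad_def by blast
  have finbad: "finite (bad a)" for a using fin by (auto simp: bad_def finite_Domain)
  have pick: "\<exists>x\<in>S. x \<notin> F" if "finite F" "card F < card S" for S F :: "'a set"
    using that by (meson card_mono not_le subsetI)
  have three: "card {p, q, r} \<le> 3" for p q r :: 'a
    by (simp add: card_insert_if)
  \<comment> \<open>Two bad sets and three further vertices exclude at most \<open>2 * D + 3\<close>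
    of the neighbours of \<open>b\<close>. Applications with fewer exclusions repeat an
    argument.\<close>
  have nbr: "\<exists>x. (x, b) \<in> R \<and> x \<notin> bad a \<and> x \<notin> bad a' \<and> x \<noteq> p \<and> x \<noteq> q \<and> x \<noteq> r"
    if "b \<in> Range R" "a \<in> Domain R" "a' \<in> Domain R" for a a' b p q r
  proof -
    have "card (bad a \<union> bad a' \<union> {p, q, r}) \<le> card (bad a) + card (bad a') + card {p, q, r}"
      by (meson add_right_mono card_Un_le le_trans)
    also have "\<dots> < 2 * D + 4" using D(1)[of a] D(1)[of a'] that three[of p q r] by linarith
    also have "\<dots> \<le> card (R\<inverse> `` {b})" using D(2) that by blast
    finally show ?thesis using pick[of "bad a \<union> bad a' \<union> {p, q, r}"] finbad by fastforce
  qed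
  have mid: "\<exists>c. (a, c) \<in> R \<and> (x, c) \<in> R \<and> c \<noteq> p \<and> c \<noteq> q \<and> c \<noteq> r"
    if "x \<in> Domain R" "x \<notin> bad a" for a x p q r
  proof -
    have "card {p, q, r} < card (R `` {a} \<inter> R `` {x})"
      using that three[of p q r] by (simp add: bad_def)
    then show ?thesis using pick[of "{p, q, r}"] by fastforce
  qed
  have cyc: "cycle_in V ?E vs" if "3 \<le> length vs" "distinct vs" "set vs \<subseteq> Domain R \<union> Range R"
      "cycle_edges vs \<subseteq> ?E" for vs
    using that V by (intro cycle_inI) blast+
  have edge: "{a, b} \<in> ?E" "{b, a} \<in> ?E" if "(a, b) \<in> R" for a b
    using that by (auto simp: insert_commute)
  have ne: "a \<noteq> b" "b \<noteq> a" if "(a, u) \<in> R" "(w, b) \<in> R" for a b u w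
    using that disj by auto
  have same_left: "\<exists>vs. cycle_in V ?E vs \<and> length vs = 6 \<and> {a, b} \<in> cycle_edges vs \<and> {a, b'} \<in> cycle_edges vs"
    if e: "(a, b) \<in> R" "(a, b') \<in> R" "b \<noteq> b'" for a b b'
  proof -
    \<comment> \<open>Only the pair \<open>x\<close>, \<open>y\<close> has to be linked through a
      new vertex, so \<open>x\<close> is arbitrary and \<open>y\<close> is chosen good with
      \<open>x\<close>.\<close>
    obtain x where x: "(x, b) \<in> R" "x \<noteq> a" using nbr[of b a a a a a] e by blast
    obtain y where y: "(y, b') \<in> R" "y \<notin> bad x" "y \<noteq> a" "y \<noteq> x" using nbr[of b' x x a x x] e x by blast
    obtain c where c: "(x, c) \<in> R" "(y, c) \<in> R" "c \<noteq> b" "c \<noteq> b'" using mid[of y x b b' b] y by blast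
    have "cycle_in V ?E [a, b, x, c, y, b']"
    proof (rule cyc)
      show "distinct [a, b, x, c, y, b']" using e x y c ne by auto
      show "set [a, b, x, c, y, b'] \<subseteq> Domain R \<union> Range R" using e x y c by auto
      show "cycle_edges [a, b, x, c, y, b'] \<subseteq> ?E"
        unfolding cycle_edges_6 using e x y c edge by blast
    qed simp
    then show ?thesis
      by (intro exI[of _ "[a, b, x, c, y, b']"]) (auto simp: cycle_edges_6 insert_commute)
  qed
  have same_right: "\<exists>vs. cycle_in V ?E vs \<and> length vs = 6 \<and> {a, b} \<in> cycle_edges vs \<and> {a', b} \<in> cycle_edges vs"
    if e: "(a, b) \<in> R" "(a', b) \<in> R" "a \<noteq> a'" for a a' b
  proof -
    \<comment> \<open>Here \<open>x\<close> is linked to both \<open>a\<close> and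
      \<open>a'\<close>, so two different bad sets are avoided at once; this accounts for the factor
      2 in \<open>2 * D + 4\<close>.\<close>
    obtain x where x: "(x, b) \<in> R" "x \<notin> bad a" "x \<notin> bad a'" "x \<noteq> a" "x \<noteq> a'"
      using nbr[of b a a' a a' a] e by blast
    obtain c where c: "(a, c) \<in> R" "(x, c) \<in> R" "c \<noteq> b" using mid[of x a b b b] x by blast
    obtain c' where c': "(a', c') \<in> R" "(x, c') \<in> R" "c' \<noteq> b" "c' \<noteq> c" using mid[of x a' b c b] x by blast
    have "cycle_in V ?E [b, a, c, x, c', a']"
    proof (rule cyc)
      show "distinct [b, a, c, x, c', a']" using e x c c' ne by auto
      show "set [b, a, c, x, c', a'] \<subseteq> Domain R \<union> Range R" using e x c c' by auto
      show "cycle_edges [b, a, c, x, c', a'] \<subseteq> ?E"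
        unfolding cycle_edges_6 using e x c c' edge by blast
    qed simp
    then show ?thesis
      by (intro exI[of _ "[b, a, c, x, c', a']"]) (auto simp: cycle_edges_6 insert_commute)
  qed
  have apart: "\<exists>vs. cycle_in V ?E vs \<and> length vs = 8 \<and> {a, b} \<in> cycle_edges vs \<and> {a', b'} \<in> cycle_edges vs"
    if e: "(a, b) \<in> R" "(a', b') \<in> R" "a \<noteq> a'" "b \<noteq> b'" for a a' b b'
  proof -
    obtain x where x: "(x, b') \<in> R" "x \<notin> bad a" "x \<noteq> a" "x \<noteq> a'"
      using nbr[of b' a a a a' a] e by blast
    obtain y where y: "(y, b) \<in> R" "y \<notin> bad a'" "y \<noteq> a" "y \<noteq> a'" "y \<noteq> x"
      using nbr[of b a' a' a a' x] e by blast
    obtain c where c: "(a, c) \<in> R" "(x, c) \<in> R" "c \<noteq> b" "c \<noteq> b'" using mid[of x a b b' b] x by blast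
    \<comment> \<open>Three right vertices are excluded here, hence the threshold of four common
      neighbours in \<open>rich\<close>.\<close>
    obtain c' where c': "(a', c') \<in> R" "(y, c') \<in> R" "c' \<noteq> b" "c' \<noteq> b'" "c' \<noteq> c"
      using mid[of y a' b b' c] y by blast
    have "cycle_in V ?E [a, b, y, c', a', b', x, c]"
    proof (rule cyc)
      show "distinct [a, b, y, c', a', b', x, c]" using e x y c c' ne by auto
      show "set [a, b, y, c', a', b', x, c] \<subseteq> Domain R \<union> Range R" using e x y c c' by auto
      show "cycle_edges [a, b, y, c', a', b', x, c] \<subseteq> ?E"
        unfolding cycle_edges_8 using e x y c c' edge by blast
    qed simp
    then show ?thesis
      by (intro exI[of _ "[a, b, y, c', a', b', x, c]"]) (auto simp: cycle_edges_8 insert_commute)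
  qed
  show ?thesis
    unfolding strongly_C8_connected_def C8_connected_def
  proof (intro conjI ballI impI)
    fix e f assume "e \<in> ?E" "f \<in> ?E" "e \<noteq> f"
    then obtain a b a' b' where ef: "e = {a, b}" "f = {a', b'}" "(a, b) \<in> R" "(a', b') \<in> R" "a \<noteq> a' \<or> b \<noteq> b'"
      by auto
    then consider "a = a'" "b \<noteq> b'" | "a \<noteq> a'" "b = b'" | "a \<noteq> a'" "b \<noteq> b'" by blast
    then show "\<exists>vs. cycle_in V ?E vs \<and> even (length vs) \<and> length vs \<le> 8 \<and>
        e \<in> cycle_edges vs \<and> f \<in> cycle_edges vs"
    proof cases
      case 1
      then show ?thesis using same_left[of a b b'] ef by force
    next
      case 2
      then show ?thesis using same_right[of a b a'] ef by force
    next
      case 3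
      then show ?thesis using apart[of a b a' b'] ef by force
    qed
  next
    fix e f assume *: "e \<in> ?E" "f \<in> ?E" "e \<noteq> f \<and> e \<inter> f \<noteq> {}"
    then obtain a b a' b' where ef: "e = {a, b}" "f = {a', b'}" "(a, b) \<in> R" "(a', b') \<in> R" "a \<noteq> a' \<or> b \<noteq> b'"
      by auto
    moreover have "a = a' \<or> b = b'" using * ef ne[of a b a' b'] ne[of a' b' a b] by auto
    ultimately consider "a = a'" "b \<noteq> b'" | "a \<noteq> a'" "b = b'" by blast
    then show "\<exists>vs. cycle_in V ?E vs \<and> length vs \<le> 6 \<and> e \<in> cycle_edges vs \<and> f \<in> cycle_edges vs"
    proof cases
      case 1
      then show ?thesis using same_left[of a b b'] ef by force
    next
      case 2
      then show ?thesis using same_right[of a b a'] ef by force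
    qed
  qed
qed

section \<open>Back to graphs, and the choice of the minimum degree\<close>

lemma bipartite_strongly_C8_connected_subgraph:
  fixes V :: "'a set" and n d :: nat
  assumes G: "simple_graph V E" and AB: "A \<subseteq> V" "B \<subseteq> V" "A \<inter> B = {}"
    and R: "R \<subseteq> A \<times> B" "\<And>a b. (a, b) \<in> R \<Longrightarrow> {a, b} \<in> E"
    and card: "card A \<le> card B" "card B \<le> n" "B \<noteq> {}"
    and deg: "\<And>a. a \<in> A \<Longrightarrow> d \<le> card (R `` {a})" "\<And>b. b \<in> B \<Longrightarrow> d \<le> card (R\<inverse> `` {b})"
    and d: "1024 * n ^ 4 \<le> d ^ 5" "40 * n \<le> d ^ 2"
  shows "\<exists>E'. subgraph V E' V E \<and> 3 * d ^ 2 \<le> 8 * card E' \<and> strongly_C8_connected V E'"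
proof -
  have fin: "finite A" "finite B"
    using G AB by (auto simp: simple_graph_def intro: finite_subset)
  obtain R' where R': "R' \<subseteq> R" "3 * d ^ 2 \<le> 8 * card R'" "rich R'"
    using rich_subrelation[OF fin R(1) card deg d] by blast
  have finR': "finite R'" using fin R(1) R'(1) by (meson finite_SigmaI finite_subset)
  let ?E = "(\<lambda>(a, b). {a, b}) ` R'"
  \<comment> \<open>As the sides are disjoint, an edge determines its ordered pair, and no edges are
    lost in the count.\<close>
  have "inj_on (\<lambda>(a, b). {a, b}) R'"
    using R(1) R'(1) AB(3) by (fastforce simp: inj_on_def doubleton_eq_iff)
  then have "card ?E = card R'" by (rule card_image)
  moreover have "strongly_C8_connected V ?E"
    using R(1) R'(1) AB by (intro rich_strongly_C8_connected R'(3) finR') blast+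
  moreover have "?E \<subseteq> E" using R(2) R'(1) by auto
  then have "subgraph V ?E V E"
    using G by (simp only: subgraph_def simple_graph_def) (meson subset_refl subsetD)
  ultimately show ?thesis
    using R'(2) by (intro exI[of _ ?E]) simp
qed

text \<open>With \<open>x = n powr (1 - \<beta>)\<close> take \<open>d\<close> to be
  \<open>x / 3\<close> rounded down. Then \<open>d \<le> x / 3\<close> gives the strict upper bound,
  and \<open>x / 4 \<le> d\<close>, valid once \<open>12 \<le> x\<close>, gives the lower
  bounds.\<close>

lemma ex_degree_parameter:
  fixes \<beta> :: real
  assumes "0 < \<beta>" "\<beta> < 1 / 5"
  shows "\<exists>n0. \<forall>n\<ge>n0. \<exists>d. 1024 * n ^ 4 \<le> d ^ 5 \<and> 40 * n \<le> d ^ 2 \<and>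
           real (2 * d * n) < real n powr (2 - \<beta>) \<and> real n powr (2 - 2 * \<beta>) \<le> 16 * real d ^ 2"
proof -
  \<comment> \<open>This makes \<open>n powr (1 - 5 * \<beta>)\<close> at least
    \<open>2 ^ 20 = 1024 * 4 ^ 5\<close>: one factor 1024 is asked for in the bound on
    \<open>d ^ 5\<close>, the other pays for \<open>d\<close> being only
    \<open>x / 4\<close>.\<close>
  define n0 where "n0 = nat \<lceil>(2 ^ 20) powr (1 / (1 - 5 * \<beta>))\<rceil> + 1"
  show ?thesis
  proof (rule exI[of _ n0], intro allI impI)
    fix n :: nat
    assume "n0 \<le> n"
    then have n: "(2 ^ 20) powr (1 / (1 - 5 * \<beta>)) \<le> real n" "1 \<le> real n"
      unfolding n0_def by linarith+
    define x where "x = real n powr (1 - \<beta>)"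
    define d where "d = nat \<lfloor>x / 3\<rfloor>"
    have "(2 ^ 20 :: real) = ((2 ^ 20) powr (1 / (1 - 5 * \<beta>))) powr (1 - 5 * \<beta>)"
      using assms by (simp add: powr_powr)
    also have "\<dots> \<le> real n powr (1 - 5 * \<beta>)"
      using n assms by (intro powr_mono2) auto
    finally have big: "2 ^ 20 \<le> real n powr (1 - 5 * \<beta>)" .
    have x_big: "2 ^ 20 \<le> x" and n2: "2 ^ 20 \<le> real n powr (1 - 2 * \<beta>)"
      using n assms unfolding x_def by (intro order.trans[OF big] powr_mono; simp)+
    have x12: "12 \<le> x" using x_big by simp
    have d: "x / 4 \<le> d" "d \<le> x / 3"
      unfolding d_def using x12 by linarith+
    have x2: "x ^ 2 = real n powr (2 - 2 * \<beta>)" and x5: "x ^ 5 = real n powr (5 - 5 * \<beta>)"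
      using n by (simp_all add: x_def powr_power algebra_simps)
    have "x ^ 2 = real n * real n powr (1 - 2 * \<beta>)"
      using n powr_add[of n 1 "1 - 2 * \<beta>"] by (simp add: x2)
    also have "\<dots> \<ge> real n * 2 ^ 20" using n2 by (intro mult_left_mono) auto
    finally have x2_big: "real n * 2 ^ 20 \<le> x ^ 2" .
    have "x ^ 5 = real n ^ 4 * real n powr (1 - 5 * \<beta>)"
      using n powr_add[of n 4 "1 - 5 * \<beta>"] by (simp add: x5)
    also have "\<dots> \<ge> real n ^ 4 * 2 ^ 20" using big by (intro mult_left_mono) auto
    finally have x5_big: "real n ^ 4 * 2 ^ 20 \<le> x ^ 5" .
    have dx2: "x ^ 2 / 16 \<le> real d ^ 2"
      using power_mono[OF d(1), of 2] x_big by (simp add: power_divide)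
    have dx5: "x ^ 5 / 1024 \<le> real d ^ 5"
      using power_mono[OF d(1), of 5] x_big by (simp add: power_divide)
    have "real (1024 * n ^ 4) \<le> real (d ^ 5)" using dx5 x5_big by simp
    moreover have "real (40 * n) \<le> real (d ^ 2)" using dx2 x2_big by simp
    moreover have "real (2 * d * n) < real n powr (2 - \<beta>)"
    proof -
      have "real (2 * d * n) \<le> 2 * (x / 3) * n" using mult_right_mono[OF d(2), of "2 * real n"] by simp
      also have "\<dots> < x * n" using x_big n by simp
      also have "\<dots> = real n powr (2 - \<beta>)"
        using n powr_add[of n "1 - \<beta>" 1] by (simp add: x_def)
      finally show ?thesis .
    qed
    ultimately show "\<exists>d. 1024 * n ^ 4 \<le> d ^ 5 \<and> 40 * n \<le> d ^ 2 \<and>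
        real (2 * d * n) < real n powr (2 - \<beta>) \<and> real n powr (2 - 2 * \<beta>) \<le> 16 * real d ^ 2"
      using dx2 unfolding x2 of_nat_le_iff by (intro exI[of _ d]) auto
  qed
qed

text \<open>The cut costs a factor 2 in the number of edges, which leaves exactly the hypothesis of
  \<open>min_degree_subgraph\<close>.\<close>

lemma strongly_C8_connected_subgraph:
  fixes V :: "'a set" and d :: nat
  assumes G: "simple_graph V E" and E: "2 * d * card V < card E"
    and d: "1024 * card V ^ 4 \<le> d ^ 5" "40 * card V \<le> d ^ 2"
  shows "\<exists>E'. subgraph V E' V E \<and> 3 * d ^ 2 \<le> 8 * card E' \<and> strongly_C8_connected V E'"
proof -
  have finV: "finite V" and edges: "\<And>e. e \<in> E \<Longrightarrow> e \<subseteq> V \<and> card e = 2"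
    using G by (auto simp: simple_graph_def)
  obtain X where X: "X \<subseteq> V"
      "card E \<le> 2 * card {(x, y). x \<in> X \<and> y \<in> V - X \<and> {x, y} \<in> E}" (is "_ \<le> 2 * card ?R")
    using max_cut[OF finV edges] by auto
  have fin: "finite X" "finite (V - X)" using X(1) finV finite_subset by auto
  have "card X + card (V - X) = card V"
    using X(1) finV by (metis card_Diff_subset card_mono fin(1) le_add_diff_inverse)
  then have "d * (card X + card (V - X)) < card ?R" using E X(2) by simp
  moreover have "?R \<subseteq> X \<times> (V - X)" by auto
  ultimately obtain A B where
    AB: "A \<subseteq> X" "B \<subseteq> V - X" "?R \<inter> A \<times> B \<noteq> {}"
      "\<And>a. a \<in> A \<Longrightarrow> d \<le> card ((?R \<inter> A \<times> B) `` {a})"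
      "\<And>b. b \<in> B \<Longrightarrow> d \<le> card ((?R \<inter> A \<times> B)\<inverse> `` {b})"
    using min_degree_subgraph[OF fin, of ?R d] by blast
  define R where "R = ?R \<inter> A \<times> B"
  note AB = AB[folded R_def]
  have sub: "A \<subseteq> V" "B \<subseteq> V" "A \<inter> B = {}" and ne: "A \<noteq> {}" "B \<noteq> {}" and R: "R \<subseteq> A \<times> B"
    using AB(1-3) X(1) by (auto simp: R_def)
  have RE: "{a, b} \<in> E" if "(a, b) \<in> R" for a b
    using that by (simp add: R_def)
  have le: "card A \<le> card V" "card B \<le> card V" using sub finV by (auto intro: card_mono)
  show ?thesis
  proof (cases "card A \<le> card B")
    case True
    show ?thesis
      by (rule bipartite_strongly_C8_connected_subgraph[OF G sub R RE True le(2) ne(2) AB(4,5) d])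
  next
    case False
    \<comment> \<open>Reversing the relation puts the smaller side on the left.\<close>
    have "R\<inverse> \<subseteq> B \<times> A" "B \<inter> A = {}" "card B \<le> card A" using R sub(3) False by auto
    moreover have "{a, b} \<in> E" if "(a, b) \<in> R\<inverse>" for a b
      using RE[of b a] that by (simp add: insert_commute)
    ultimately show ?thesis
      using bipartite_strongly_C8_connected_subgraph[of V E B A "R\<inverse>" "card V" d] G sub le ne AB(4,5) d
      by auto
  qed
qed

theorem theorem1:
  fixes \<beta> :: real
  assumes "0 < \<beta>" and "\<beta> < 1 / 5"
  shows "\<exists>n0::nat. \<forall>n\<ge>n0. \<forall>(V :: 'a set) E.
           simple_graph V E \<and> card V = n \<and> real (card E) \<ge> real n powr (2 - \<beta>) \<longrightarrow>
           (\<exists>V' E'. subgraph V' E' V E \<and>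
                    real (card E') \<ge> 1 / 64 * real n powr (2 - 2 * \<beta>) \<and>
                    strongly_C8_connected V' E')"
proof -
  obtain n0 where n0: "\<forall>n\<ge>n0. \<exists>d. 1024 * n ^ 4 \<le> d ^ 5 \<and> 40 * n \<le> d ^ 2 \<and>
      real (2 * d * n) < real n powr (2 - \<beta>) \<and> real n powr (2 - 2 * \<beta>) \<le> 16 * real d ^ 2"
    using ex_degree_parameter[OF assms] by blast
  show ?thesis
  proof (intro exI[of _ n0] allI impI, elim conjE)
    fix n and V :: "'a set" and E
    assume "n0 \<le> n" and G: "simple_graph V E" "card V = n" "real n powr (2 - \<beta>) \<le> real (card E)"
    then obtain d where d: "1024 * n ^ 4 \<le> d ^ 5" "40 * n \<le> d ^ 2"
        "real (2 * d * n) < real n powr (2 - \<beta>)" "real n powr (2 - 2 * \<beta>) \<le> 16 * real d ^ 2"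
      using n0 by blast
    have "2 * d * n < card E" using d(3) G(3) by linarith
    then obtain E' where E': "subgraph V E' V E" "3 * d ^ 2 \<le> 8 * card E'" "strongly_C8_connected V E'"
      using strongly_C8_connected_subgraph[of V E d] G(1,2) d(1,2) by auto
    have "real (3 * d ^ 2) \<le> real (8 * card E')" using E'(2) by (simp only: of_nat_le_iff)
    \<comment> \<open>The constant obtained is \<open>3 / 8 * 1 / 16 = 3 / 128\<close>, which
      exceeds \<open>1 / 64\<close>.\<close>
    then have "1 / 64 * real n powr (2 - 2 * \<beta>) \<le> real (card E')" using d(4) by simp
    then show "\<exists>V' E'. subgraph V' E' V E \<and>
        real (card E') \<ge> 1 / 64 * real n powr (2 - 2 * \<beta>) \<and> strongly_C8_connected V' E'"
      using E' by blast
  qed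
qed

end
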